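(* Consider words over the two letters $f_0,f_1$ and the infinite system of relations $$f_0^2=1,\quad r_0,\ r_1,\ r_2,\ \dots,\qquad\text{where}\quad r_p:\ \ f_1(f_0f_1)^p(f_1f_0)^pf_1^2=f_1(f_0f_1)^p(f_1f_0)^p\quad(p\ge0).$$ This system is minimal, that is, none of the relations follows from the others.
   Context: Relations are understood as relations of a monoid presentation on the generators $f_0,f_1$ ($1$ denotes the empty word). A relation $v=w$ follows from a set $R$ of relations if $v$ and $w$ are identified by the smallest congruence on the free monoid $\{f_0,f_1\}^*$ containing all pairs in $R$, i.e. if $v$ can be transformed into $w$ by finitely many replacements of a subword equal to one side of a relation in $R$ by the other side. *)

theory Defs
  imports Main
begin

datatype letter = F0 | F1

type_synonym 'a word = "'a list"

text \<open>A relation v = w of a monoid presentation is encoded as the pair (v, w) of words over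
  the generators; the free monoid is the type of lists with append.\<close>
type_synonym 'a relation = "'a word \<times> 'a word"

definition monoid_congruence :: "'a relation set \<Rightarrow> bool" where
  "monoid_congruence C \<longleftrightarrow>
     equiv UNIV C \<and> (\<forall>u u' v v'. (u, u') \<in> C \<longrightarrow> (v, v') \<in> C \<longrightarrow> (u @ v, u' @ v') \<in> C)"

definition generated_congruence :: "'a relation set \<Rightarrow> 'a relation set" where
  "generated_congruence R = \<Inter> {C. monoid_congruence C \<and> R \<subseteq> C}"

definition follows_from :: "'a relation \<Rightarrow> 'a relation set \<Rightarrow> bool" where
  "follows_from r R \<longleftrightarrow> r \<in> generated_congruence R"

definition minimal_system :: "'a relation set \<Rightarrow> bool" where
  "minimal_system R \<longleftrightarrow> (\<forall>r\<in>R. \<not> follows_from r (R - {r}))"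

definition word_power :: "'a word \<Rightarrow> nat \<Rightarrow> 'a word" where
  "word_power w n = concat (replicate n w)"

definition f0_involution :: "letter relation" where
  "f0_involution = (word_power [F0] 2, [])"

definition r_relation :: "nat \<Rightarrow> letter relation" where
  "r_relation p =
     ([F1] @ word_power [F0, F1] p @ word_power [F1, F0] p @ word_power [F1] 2,
      [F1] @ word_power [F0, F1] p @ word_power [F1, F0] p)"

text \<open>Indexing the relations does not collapse any of them, so removing a member of the set
  removes exactly one relation of the system.\<close>

lemma inj_r_relation: "inj r_relation"
proof (rule injI)
  fix p q assume "r_relation p = r_relation q"
  then have "length (snd (r_relation p)) = length (snd (r_relation q))" by simp
  then show "p = q" by (simp add: r_relation_def word_power_def length_concat sum_list_replicate)
qed

lemma f0_involution_neq_r_relation: "f0_involution \<noteq> r_relation p"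
  by (simp add: f0_involution_def r_relation_def)

lemma monoid_congruence_generated: "monoid_congruence (generated_congruence R)"
proof -
  let ?G = "generated_congruence R"
  have mem: "z \<in> ?G \<longleftrightarrow> (\<forall>C. monoid_congruence C \<longrightarrow> R \<subseteq> C \<longrightarrow> z \<in> C)" for z
    unfolding generated_congruence_def by auto
  have eq: "refl C" "sym C" "trans C" if "monoid_congruence C" for C :: "'a relation set"
    using that by (simp_all add: monoid_congruence_def equiv_def)
  have "refl ?G"
    by (rule refl_onI) (simp add: mem eq(1)[THEN reflD])
  moreover have "sym ?G"
    by (rule symI) (simp add: mem, metis eq(2) symD)
  moreover have "trans ?G"
    by (rule transI) (simp add: mem, metis eq(3) transD)
  moreover have "(u @ v, u' @ v') \<in> ?G" if "(u, u') \<in> ?G" "(v, v') \<in> ?G" for u u' v v'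
    using that by (simp add: mem monoid_congruence_def)
  ultimately show ?thesis
    by (simp add: monoid_congruence_def equiv_def)
qed

text \<open>The generated congruence is the relation of being connected by finitely many replacements
  of a subword equal to one side of a relation by the other side.\<close>

definition rewrite_step :: "'a relation set \<Rightarrow> 'a relation set" where
  "rewrite_step R = {(x @ v @ y, x @ w @ y) | x v w y. (v, w) \<in> R \<or> (w, v) \<in> R}"

lemma rewrite_step_context:
  assumes "(u, v) \<in> (rewrite_step R)\<^sup>*"
  shows "(x @ u @ y, x @ v @ y) \<in> (rewrite_step R)\<^sup>*"
  using assms
proof (induction rule: rtrancl_induct)
  case base
  then show ?case by simp
next
  case (step b c)
  then obtain x' v' w' y' where bc: "b = x' @ v' @ y'" "c = x' @ w' @ y'"
      and r: "(v', w') \<in> R \<or> (w', v') \<in> R"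
    unfolding rewrite_step_def by blast
  have "((x @ x') @ v' @ (y' @ y), (x @ x') @ w' @ (y' @ y)) \<in> rewrite_step R"
    unfolding rewrite_step_def using r by blast
  then have "(x @ b @ y, x @ c @ y) \<in> rewrite_step R"
    by (simp add: bc)
  then show ?case using step.IH by (rule rtrancl_into_rtrancl[rotated])
qed

lemma generated_congruence_eq_rewrite: "generated_congruence R = (rewrite_step R)\<^sup>*"
proof
  have "sym (rewrite_step R)"
    unfolding rewrite_step_def sym_def by blast
  moreover have "(u @ v, u' @ v') \<in> (rewrite_step R)\<^sup>*"
    if "(u, u') \<in> (rewrite_step R)\<^sup>*" "(v, v') \<in> (rewrite_step R)\<^sup>*" for u u' v v'
    using rewrite_step_context[OF that(1), of "[]" v] rewrite_step_context[OF that(2), of u' "[]"]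
    by simp
  ultimately have "monoid_congruence ((rewrite_step R)\<^sup>*)"
    unfolding monoid_congruence_def equiv_def
    by (auto simp: refl_rtrancl sym_rtrancl trans_rtrancl)
  moreover have "R \<subseteq> (rewrite_step R)\<^sup>*"
  proof (rule subrelI)
    fix v w assume "(v, w) \<in> R"
    then have "([] @ v @ [], [] @ w @ []) \<in> rewrite_step R"
      unfolding rewrite_step_def by blast
    then show "(v, w) \<in> (rewrite_step R)\<^sup>*" by auto
  qed
  ultimately show "generated_congruence R \<subseteq> (rewrite_step R)\<^sup>*"
    unfolding generated_congruence_def by blast
next
  have eq: "refl (generated_congruence R)" "sym (generated_congruence R)" "trans (generated_congruence R)"
    and app: "\<And>u u' v v'. (u, u') \<in> generated_congruence R \<Longrightarrow> (v, v') \<in> generated_congruence R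
      \<Longrightarrow> (u @ v, u' @ v') \<in> generated_congruence R"
    using monoid_congruence_generated[of R] by (simp_all add: monoid_congruence_def equiv_def)
  have R: "R \<subseteq> generated_congruence R"
    unfolding generated_congruence_def by blast
  have step: "(b, c) \<in> generated_congruence R" if bc: "(b, c) \<in> rewrite_step R" for b c
  proof -
    obtain x v w y where bc': "b = x @ v @ y" "c = x @ w @ y"
        and r: "(v, w) \<in> R \<or> (w, v) \<in> R"
      using bc unfolding rewrite_step_def by blast
    have "(v, w) \<in> generated_congruence R"
      using r R eq(2) by (blast dest: symD)
    then show ?thesis
      unfolding bc' by (intro app reflD[OF eq(1)])
  qed
  show "(rewrite_step R)\<^sup>* \<subseteq> generated_congruence R"
  proof (rule subrelI)
    fix u v assume "(u, v) \<in> (rewrite_step R)\<^sup>*"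
    then show "(u, v) \<in> generated_congruence R"
      by (induction rule: rtrancl_induct) (use eq step in \<open>blast dest: reflD transD\<close>)+
  qed
qed

end

theory Submission
  imports Defs
begin

text \<open>
  A relation fails to follow from a set \<open>R\<close> of relations as soon as the free monoid acts on some
  set of states so that every relation of \<open>R\<close> holds while the given one does not
  (\<open>follows_from_imp_fold_eq\<close>). Words act from the right, by \<open>fold\<close>. Three kinds of actions
  suffice. Write \<open>a\<close> and \<open>b\<close> for the actions of \<open>f\<^sub>0\<close> and \<open>f\<^sub>1\<close>.

  For \<open>f\<^sub>0\<^sup>2 = 1\<close>, distinguish empty from nonempty words: every \<open>r\<^sub>p\<close> relates nonempty words.

  For \<open>r\<^sub>0\<close>, that is \<open>f\<^sub>1\<^sup>3 = f\<^sub>1\<close>, count the letters \<open>f\<^sub>1\<close> up to \<open>2\<close>: if \<open>p \<ge> 1\<close>, both sides of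
  \<open>r\<^sub>p\<close> contain at least three of them.

  For \<open>r\<^sub>m\<close> with \<open>m \<ge> 1\<close>, take the chain of states \<open>0, ..., 2 m + 1\<close>. The involution \<open>a\<close>
  exchanges \<open>2 i\<close> and \<open>2 i + 1\<close>, and \<open>b\<close> exchanges \<open>2 i - 1\<close> and \<open>2 i\<close> for \<open>1 \<le> i \<le> m\<close>. At the
  two ends of the chain \<open>b\<close> is not invertible: it sends \<open>2 m + 1\<close> back to \<open>1\<close>, and \<open>0\<close> to a sink
  outside the chain. Away from the two ends, the action of \<open>f\<^sub>1 (f\<^sub>0 f\<^sub>1)\<^sup>q (f\<^sub>1 f\<^sub>0)\<^sup>q\<close> is a walk of some
  length along the chain and the same walk back, so it ends where its first letter led, which is
  a state fixed by \<open>b\<^sup>2\<close>. The only states not fixed by \<open>b\<^sup>2\<close> are the ends. A walk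
  over the lower end is lost in the sink. A walk
  that jumps from \<open>2 m + 1\<close> to \<open>1\<close> with its last outward step starts its return at \<open>1\<close>
  and ends at \<open>2 q + 1\<close>; this is the end \<open>2 m + 1\<close> exactly if \<open>q = m\<close>. If the
  outward walk goes on after the jump, its next step already falls from \<open>1\<close> over \<open>0\<close> into the
  sink. So all relations \<open>r\<^sub>q\<close> with \<open>q \<noteq> m\<close> hold (\<open>chain_walk_inner\<close>), but \<open>r\<^sub>m\<close> does not
  (\<open>chain_walk_end\<close>).
\<close>

section \<open>Refuting consequences by actions\<close>

text \<open>The pairs of words with equal action form a congruence.\<close>

lemma follows_from_imp_fold_eq:
  assumes "follows_from (u, v) R"
    and "\<And>x y. (x, y) \<in> R \<Longrightarrow> fold act x = fold act y"
  shows "fold act u = fold act v"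
proof -
  let ?K = "{(x, y). fold act x = fold act y}"
  have "monoid_congruence ?K"
    by (auto simp: monoid_congruence_def equiv_def refl_on_def sym_def trans_def)
  moreover have "R \<subseteq> ?K"
    using assms(2) by auto
  ultimately show ?thesis
    using assms(1) unfolding follows_from_def generated_congruence_def by auto
qed

lemma fold_word_power: "fold act (word_power w n) = fold act w ^^ n"
  unfolding word_power_def by (induction n) (simp_all add: funpow_swap1 fun_eq_iff)

lemma fold_r_relation:
  fixes act :: "letter \<Rightarrow> 's \<Rightarrow> 's"
  assumes "w = (((act F0 \<circ> act F1) ^^ p) \<circ> ((act F1 \<circ> act F0) ^^ p)) (act F1 s)"
  shows "fold act (snd (r_relation p)) s = w"
    and "fold act (fst (r_relation p)) s = act F1 (act F1 w)"
  using assms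
  by (simp_all add: r_relation_def fold_word_power numeral_2_eq_2 comp_def)

lemma fold_f0_involution:
  "fold act (fst f0_involution) s = act F0 (act F0 s)"
  "fold act (snd f0_involution) s = s"
  by (simp_all add: f0_involution_def fold_word_power numeral_2_eq_2)

section \<open>The involution and the relation with index zero\<close>

lemma f0_involution_independent: "\<not> follows_from f0_involution (range r_relation)"
proof
  let ?act = "\<lambda>(_::letter) (_::bool). True"
  have True_fixed: "fold ?act xs True" for xs
    by (induction xs) auto
  assume "follows_from f0_involution (range r_relation)"
  then have "follows_from (fst f0_involution, snd f0_involution) (range r_relation)"
    by simp
  then have "fold ?act (fst f0_involution) = fold ?act (snd f0_involution)"
    by (rule follows_from_imp_fold_eq)
       (auto simp: r_relation_def True_fixed fun_eq_iff)
  then have "fold ?act (fst f0_involution) False = fold ?act (snd f0_involution) False"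
    by simp
  then show False
    by (simp add: fold_f0_involution)
qed

fun count_f1 :: "letter \<Rightarrow> nat \<Rightarrow> nat" where
  "count_f1 F0 n = n"
| "count_f1 F1 n = min 2 (Suc n)"

lemma r_relation_0_independent:
  "\<not> follows_from (r_relation 0) (insert f0_involution (range r_relation) - {r_relation 0})"
    (is "\<not> follows_from _ ?R")
proof
  assume "follows_from (r_relation 0) ?R"
  then have "follows_from (fst (r_relation 0), snd (r_relation 0)) ?R"
    by simp
  then have "fold count_f1 (fst (r_relation 0)) = fold count_f1 (snd (r_relation 0))"
  proof (rule follows_from_imp_fold_eq)
    fix x y assume "(x, y) \<in> ?R"
    then consider "(x, y) = f0_involution" | q where "q \<noteq> 0" "(x, y) = r_relation q"
      by (metis DiffE insertE rangeE singletonI)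
    then show "fold count_f1 x = fold count_f1 y"
    proof cases
      case 1
      then show ?thesis
        using fold_f0_involution[of count_f1] by (auto simp: fun_eq_iff simp flip: 1)
    next
      case (2 q)
      then obtain k where q: "q = Suc k"
        by (cases q) auto
      define d where "d = count_f1 F1 \<circ> count_f1 F0"
      define c where "c = count_f1 F0 \<circ> count_f1 F1"
      have top: "(d ^^ k) 2 = 2" "(c ^^ k) 2 = 2"
        by (induction k) (simp_all add: d_def c_def)
      have "d (count_f1 F1 s) = 2" "c 2 = 2" for s
        by (simp_all add: d_def c_def)
      then have "((c ^^ q) \<circ> (d ^^ q)) (count_f1 F1 s) = 2" for s
        unfolding q by (simp add: funpow_swap1 top)
      then have "fold count_f1 (snd (r_relation q)) s = 2"
        "fold count_f1 (fst (r_relation q)) s = 2" for s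
        using fold_r_relation[where w = 2 and act = count_f1 and p = q and s = s] by (simp_all add: c_def d_def)
      then show ?thesis
        using 2 by (metis ext fst_conv snd_conv)
    qed
  qed
  then have "fold count_f1 (fst (r_relation 0)) 0 = fold count_f1 (snd (r_relation 0)) 0"
    by simp
  then show False
    by (simp add: r_relation_def word_power_def numeral_2_eq_2)
qed

section \<open>The chain with a loop at one end and a sink at the other\<close>

text \<open>The states above \<open>2 m + 1\<close> are all fixed; only \<open>2 m + 2\<close> is entered from the chain.\<close>

fun chain :: "nat \<Rightarrow> letter \<Rightarrow> nat \<Rightarrow> nat" where
  "chain m F0 n = (if n > 2 * m + 1 then n else if even n then Suc n else n - 1)"
| "chain m F1 n =
     (if n > 2 * m + 1 then n else if n = 2 * m + 1 then 1 else if n = 0 then 2 * m + 2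
      else if odd n then Suc n else n - 1)"

abbreviation chain_out :: "nat \<Rightarrow> nat \<Rightarrow> nat" where
  "chain_out m \<equiv> chain m F1 \<circ> chain m F0"

abbreviation chain_back :: "nat \<Rightarrow> nat \<Rightarrow> nat" where
  "chain_back m \<equiv> chain m F0 \<circ> chain m F1"

definition chain_inner :: "nat \<Rightarrow> nat \<Rightarrow> bool" where
  "chain_inner m n \<longleftrightarrow> n \<noteq> 0 \<and> n \<noteq> 2 * m + 1"

lemma chain_F0_F0: "chain m F0 (chain m F0 n) = n"
  by (auto elim!: oddE evenE)

lemma chain_F1_inner: "m \<noteq> 0 \<Longrightarrow> chain_inner m (chain m F1 n)"
  by (auto simp: chain_inner_def elim!: oddE evenE)

lemma chain_F1_F1: "chain_inner m n \<Longrightarrow> chain m F1 (chain m F1 n) = n"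
  by (auto simp: chain_inner_def elim!: oddE evenE)

lemma chain_out_even: "i \<noteq> 0 \<Longrightarrow> i + q \<le> m \<Longrightarrow> (chain_out m ^^ q) (2 * i) = 2 * (i + q)"
  by (induction q) auto

lemma chain_out_odd:
  "i < m \<Longrightarrow> q \<le> i \<Longrightarrow> (chain_out m ^^ q) (2 * i + 1) = 2 * (i - q) + 1"
proof (induction q)
  case (Suc q)
  then have "2 * (i - q) + 1 = Suc (Suc (2 * (i - Suc q) + 1))" "i - Suc q < m"
    by auto
  with Suc show ?case
    by (simp del: mult_Suc_right)
qed simp

lemma chain_back_even: "i + q \<le> m \<Longrightarrow> (chain_back m ^^ q) (2 * (i + q)) = 2 * i"
proof (induction q arbitrary: i)
  case (Suc q)
  from Suc.IH[of "Suc i"] Suc.prems show ?case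
    by simp
qed simp

lemma chain_back_odd: "i + q \<le> m \<Longrightarrow> (chain_back m ^^ q) (2 * i + 1) = 2 * (i + q) + 1"
  by (induction q) auto

lemma chain_sink:
  assumes "n > 2 * m + 1"
  shows "(chain_out m ^^ q) n = n" "(chain_back m ^^ q) n = n"
  using assms by (induction q) auto

lemma chain_out_from_1: "m \<noteq> 0 \<Longrightarrow> (chain_out m ^^ Suc r) 1 = 2 * m + 2"
  using chain_sink(1)[of m "2 * m + 2" r] by (simp add: funpow_swap1)

text \<open>From an even state the outward walk leads to \<open>2 m\<close> and then, by the jump at the upper end,
  to \<open>1\<close>; from an odd state it leads down to \<open>1\<close> and then into the sink. The exponents in
  \<open>chain_out_even_jump\<close> and \<open>chain_out_odd_sink\<close> count the steps to these events.\<close>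

lemma chain_out_even_jump:
  assumes "i \<noteq> 0" "i \<le> m"
  shows "(chain_out m ^^ (m + 1 - i)) (2 * i) = 1"
proof -
  have "(chain_out m ^^ Suc (m - i)) (2 * i) = chain_out m (2 * m)"
    using chain_out_even[of i "m - i" m] assms by simp
  also have "\<dots> = 1"
    using assms by simp
  finally show ?thesis
    using assms by (simp add: Suc_diff_le)
qed

lemma chain_out_odd_sink:
  assumes "i < m" "i < q"
  shows "(chain_out m ^^ q) (2 * i + 1) = 2 * m + 2"
proof -
  obtain r where r: "q = Suc r + i"
    using assms less_iff_Suc_add[of i q] by auto
  have "(chain_out m ^^ i) (2 * i + 1) = 1"
    using chain_out_odd[of i m i] assms by simp
  then show ?thesis
    unfolding r funpow_add using chain_out_from_1[of m r] assms by simp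
qed

lemma chain_walk_inner:
  assumes "chain_inner m s" "q \<noteq> m"
  shows "chain_inner m ((chain_back m ^^ q) ((chain_out m ^^ q) s))"
proof -
  have sink: "chain_inner m (2 * m + 2)"
    by (simp add: chain_inner_def)
  consider "s > 2 * m + 1"
    | i where "s = 2 * i" "i \<noteq> 0" "i \<le> m"
    | i where "s = 2 * i + 1" "i < m"
    using assms(1) unfolding chain_inner_def
    by (cases "even s") (fastforce elim!: evenE oddE)+
  then show ?thesis
  proof cases
    case 1
    then show ?thesis
      using assms(1) by (simp add: chain_sink)
  next
    case (2 i)
    consider "i + q \<le> m" | "q = m + 1 - i" | "m + 1 - i < q"
      by linarith
    then show ?thesis
    proof cases
      case 1
      then show ?thesis
        using assms(1) chain_out_even[OF 2(2) 1] chain_back_even[OF 1]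
        by (simp only: 2(1))
    next
      case jump: 2
      then have "(chain_out m ^^ q) s = 1"
        using 2 chain_out_even_jump[of i m] by simp
      moreover have "(chain_back m ^^ q) 1 = 2 * q + 1"
        using chain_back_odd[of 0 q m] 2 jump by simp
      ultimately show ?thesis
        using assms(2) by (simp add: chain_inner_def)
    next
      case 3
      then obtain r where r: "q = Suc r + (m + 1 - i)"
        using less_iff_Suc_add[of "m + 1 - i" q] by auto
      have "(chain_out m ^^ q) s = 2 * m + 2"
        unfolding r funpow_add
        using chain_out_even_jump[of i m] chain_out_from_1[of m r] 2 by simp
      then show ?thesis
        using sink by (simp add: chain_sink)
    qed
  next
    case (3 i)
    show ?thesis
    proof (cases "q \<le> i")
      case True
      then have "(chain_out m ^^ q) s = 2 * (i - q) + 1"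
        using 3 chain_out_odd by simp
      moreover have "(chain_back m ^^ q) (2 * (i - q) + 1) = s"
        using chain_back_odd[of "i - q" q m] True 3 by simp
      ultimately show ?thesis
        using assms(1) by simp
    next
      case False
      then have "(chain_out m ^^ q) s = 2 * m + 2"
        using 3 chain_out_odd_sink[of i m q] by simp
      then show ?thesis
        using sink by (simp add: chain_sink)
    qed
  qed
qed

text \<open>The walk from \<open>2\<close> makes the jump with its \<open>m\<close>-th and last step.\<close>

lemma chain_walk_end:
  assumes "m \<noteq> 0"
  shows "(chain_back m ^^ m) ((chain_out m ^^ m) 2) = 2 * m + 1"
  using chain_out_even_jump[of 1 m] chain_back_odd[of 0 m m] assms by simp

lemma r_relation_independent:
  assumes "m \<noteq> 0"
  shows "\<not> follows_from (r_relation m) (insert f0_involution (range r_relation) - {r_relation m})"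
    (is "\<not> follows_from _ ?R")
proof
  assume "follows_from (r_relation m) ?R"
  then have "follows_from (fst (r_relation m), snd (r_relation m)) ?R"
    by simp
  then have "fold (chain m) (fst (r_relation m)) = fold (chain m) (snd (r_relation m))"
  proof (rule follows_from_imp_fold_eq)
    fix x y assume "(x, y) \<in> ?R"
    then consider "(x, y) = f0_involution" | q where "q \<noteq> m" "(x, y) = r_relation q"
      by (metis DiffE insertE rangeE singletonI)
    then show "fold (chain m) x = fold (chain m) y"
    proof cases
      case 1
      then have "x = fst f0_involution" "y = snd f0_involution"
        by (metis fst_conv, metis snd_conv)
      then show ?thesis
        by (intro ext) (simp only: fold_f0_involution chain_F0_F0)
    next
      case (2 q)
      have "fold (chain m) (fst (r_relation q)) s = fold (chain m) (snd (r_relation q)) s" for s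
        using chain_F1_F1[OF chain_walk_inner[OF chain_F1_inner[OF assms] 2(1)]]
        by (simp only: fold_r_relation[OF refl] comp_apply)
      then show ?thesis
        using 2(2) by (metis ext fst_conv snd_conv)
    qed
  qed
  then have eq: "fold (chain m) (fst (r_relation m)) 1 = fold (chain m) (snd (r_relation m)) 1"
    by simp
  have "chain m F1 1 = 2"
    using assms by simp
  then have walk: "2 * m + 1 =
      (((chain m F0 \<circ> chain m F1) ^^ m) \<circ> ((chain m F1 \<circ> chain m F0) ^^ m)) (chain m F1 1)"
    using chain_walk_end[OF assms] by (simp only: comp_apply)
  from eq have "chain m F1 (chain m F1 (2 * m + 1)) = 2 * m + 1"
    by (simp only: fold_r_relation[OF walk])
  then show False
    using assms by simp
qed

theorem mainTheorem4:
  shows "minimal_system (insert f0_involution (range r_relation))"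
proof -
  have "insert f0_involution (range r_relation) - {f0_involution} = range r_relation"
    using f0_involution_neq_r_relation by auto
  then show ?thesis
    unfolding minimal_system_def
    using f0_involution_independent r_relation_0_independent r_relation_independent
    by (metis insertE rangeE)
qed

end
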